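(* Let $K$ be a non-archimedean local field with valuation ring $R$, and let $S\subseteq R$ be a non-empty subset with adelic tree $T_S$. Then $n!_S=n!_{T_S}$ for every integer $n\ge 0$ (with $n<|S|$ if $S$ is finite), where $n!_S$ is Bhargava's (logarithmic) $S$-factorial of $n$ and $n!_{T_S}$ is the factorial of the rooted tree $T_S$ with the standard length function.
   Context: $K$ has normalized discrete valuation $\mathrm{val}$ (with $\mathrm{val}(0)=\infty$), valuation ring $R$, maximal ideal $\mathfrak m$, and finite residue field. Bhargava's logarithmic factorials of $S$: choose $s_0\in S$ arbitrarily; given $s_0,\dots,s_{n-1}$, choose $s_n\in S$ minimizing $\mathrm{val}\bigl(\prod_{j=0}^{n-1}(s-s_j)\bigr)$ over $s\in S$; then $n!_S:=\mathrm{val}\bigl(\prod_{j=0}^{n-1}(s_n-s_j)\bigr)$, a number independent of the choices. Adelic tree $T_S$: for each integer $h\ge0$ let $\phi_h:R\to R/\mathfrak m^h$ be the projection and $V_h=\phi_h(S)$. The vertex set of $T_S$ is $\bigsqcup_{h\ge0}V_h$, the root is the unique element of $V_0$, and $u\in V_h$ is adjacent to $v\in V_{h+1}$ if and only if $u$ is the image of $v$ under the natural map $R/\mathfrak m^{h+1}\to R/\mathfrak m^h$. Tree factorials (standard length): for a rooted tree $T$ with root $\mathfrak r$ and edges oriented away from $\mathfrak r$, the extended boundary $\widetilde\partial T$ is the set of all infinite oriented paths from $\mathfrak r$ and all oriented paths from $\mathfrak r$ to a leaf (a leaf is a vertex $\neq\mathfrak r$ of valence one, or $\mathfrak r$ if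 $T=\{\mathfrak r\}$). For distinct $\rho,\tau\in\widetilde\partial T$, $\langle\rho,\tau\rangle$ is the number of common edges. Choose $\rho_0\in\widetilde\partial T$ arbitrarily; given $\rho_0,\dots,\rho_{n-1}$, choose $\rho_n\in\widetilde\partial T\setminus\{\rho_0,\dots,\rho_{n-1}\}$ minimizing $\sum_{j<n}\langle\rho,\rho_j\rangle$. Then $n!_T:=\sum_{j<n}\langle\rho_n,\rho_j\rangle$, which is independent of the choices (and $0!_T=0$). *)

theory Defs
  imports Complex_Main "HOL-Library.Extended_Real"
begin

section \<open>Non-archimedean local fields\<close>

(* A normalized discrete valuation takes values in the integers together with infinity;
   the ambient type ereal also has non-integral values and -infinity, which val_range excludes. *)

definition valuation_ring :: "('k::field \<Rightarrow> ereal) \<Rightarrow> 'k set" where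
  "valuation_ring val = {x. 0 \<le> val x}"

definition maximal_ideal :: "('k::field \<Rightarrow> ereal) \<Rightarrow> 'k set" where
  "maximal_ideal val = {x. 0 < val x}"

definition ideal_product :: "'k::field set \<Rightarrow> 'k set \<Rightarrow> 'k set" where
  "ideal_product I J = {(\<Sum>i<n. a i * b i) | (n::nat) a b. (\<forall>i<n. a i \<in> I) \<and> (\<forall>i<n. b i \<in> J)}"

primrec maximal_ideal_power :: "('k::field \<Rightarrow> ereal) \<Rightarrow> nat \<Rightarrow> 'k set" where
  "maximal_ideal_power val 0 = valuation_ring val"
| "maximal_ideal_power val (Suc h) = ideal_product (maximal_ideal val) (maximal_ideal_power val h)"

definition congruence_mod :: "'k::field set \<Rightarrow> 'k set \<Rightarrow> ('k \<times> 'k) set" where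
  "congruence_mod R I = {(x, y). x \<in> R \<and> y \<in> R \<and> x - y \<in> I}"

definition val_Cauchy :: "('k::field \<Rightarrow> ereal) \<Rightarrow> (nat \<Rightarrow> 'k) \<Rightarrow> bool" where
  "val_Cauchy val X \<longleftrightarrow> (\<forall>N::nat. \<exists>M. \<forall>i\<ge>M. \<forall>j\<ge>M. ereal (real N) \<le> val (X i - X j))"

definition val_converges_to :: "('k::field \<Rightarrow> ereal) \<Rightarrow> (nat \<Rightarrow> 'k) \<Rightarrow> 'k \<Rightarrow> bool" where
  "val_converges_to val X L \<longleftrightarrow> (\<forall>N::nat. \<exists>M. \<forall>i\<ge>M. ereal (real N) \<le> val (X i - L))"

locale nonarch_local_field =
  fixes val :: "'k::field \<Rightarrow> ereal"
  assumes val_zero: "val 0 = \<infinity>"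
    and val_range: "val ` (UNIV - {0}) = range (\<lambda>i::int. ereal (of_int i))"
    and val_mult: "val (x * y) = val x + val y"
    and val_add: "min (val x) (val y) \<le> val (x + y)"
    and complete: "val_Cauchy val X \<Longrightarrow> \<exists>L. val_converges_to val X L"
    and finite_residue_field:
      "finite (valuation_ring val // congruence_mod (valuation_ring val) (maximal_ideal val))"

section \<open>Bhargava's logarithmic factorials\<close>

(* Only the values s 0, ..., s n matter. *)
definition is_S_ordering :: "('k::field \<Rightarrow> ereal) \<Rightarrow> 'k set \<Rightarrow> nat \<Rightarrow> (nat \<Rightarrow> 'k) \<Rightarrow> bool" where
  "is_S_ordering val S n s \<longleftrightarrow>
     (\<forall>k\<le>n. s k \<in> S \<and> (\<forall>x\<in>S. val (\<Prod>j<k. s k - s j) \<le> val (\<Prod>j<k. x - s j)))"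

definition bhargava_factorial :: "('k::field \<Rightarrow> ereal) \<Rightarrow> 'k set \<Rightarrow> nat \<Rightarrow> ereal" where
  "bhargava_factorial val S n =
     (THE v. \<exists>s. is_S_ordering val S n s \<and> v = val (\<Prod>j<n. s n - s j))"

section \<open>Factorials of rooted trees\<close>

record 'v rooted_graph =
  vertices :: "'v set"
  adjacent :: "'v \<Rightarrow> 'v \<Rightarrow> bool"
  root :: 'v

definition depth :: "'v rooted_graph \<Rightarrow> 'v \<Rightarrow> nat" where
  "depth T v = (LEAST n. (root T, v) \<in> {(x, y). adjacent T x y} ^^ n)"

(* The edge {u, v} of T, oriented away from the root, goes from u to v. *)
definition oriented_edge :: "'v rooted_graph \<Rightarrow> 'v \<Rightarrow> 'v \<Rightarrow> bool" where
  "oriented_edge T u v \<longleftrightarrow> adjacent T u v \<and> depth T v = Suc (depth T u)"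

definition leaf :: "'v rooted_graph \<Rightarrow> 'v \<Rightarrow> bool" where
  "leaf T v \<longleftrightarrow> v \<in> vertices T \<and>
     (v \<noteq> root T \<and> card {u. adjacent T v u} = 1 \<or> v = root T \<and> vertices T = {root T})"

datatype 'v path = Finite_Path "'v list" | Infinite_Path "nat \<Rightarrow> 'v"

fun path_edges :: "'v path \<Rightarrow> ('v \<times> 'v) set" where
  "path_edges (Finite_Path vs) = {(vs ! i, vs ! Suc i) | i. Suc i < length vs}"
| "path_edges (Infinite_Path p) = {(p i, p (Suc i)) | i. True}"

definition extended_boundary :: "'v rooted_graph \<Rightarrow> 'v path set" where
  "extended_boundary T =
     {Infinite_Path p | p. p 0 = root T \<and> (\<forall>i. oriented_edge T (p i) (p (Suc i)))} \<union>
     {Finite_Path vs | vs. vs \<noteq> [] \<and> hd vs = root T \<and>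
        (\<forall>i. Suc i < length vs \<longrightarrow> oriented_edge T (vs ! i) (vs ! Suc i)) \<and> leaf T (last vs)}"

(* For distinct members of the extended boundary of a tree the set of common edges is finite. *)
definition common_edges :: "'v path \<Rightarrow> 'v path \<Rightarrow> nat" where
  "common_edges \<rho> \<tau> = card (path_edges \<rho> \<inter> path_edges \<tau>)"

(* Only the values \<rho> 0, ..., \<rho> n matter. *)
definition is_tree_ordering :: "'v rooted_graph \<Rightarrow> nat \<Rightarrow> (nat \<Rightarrow> 'v path) \<Rightarrow> bool" where
  "is_tree_ordering T n \<rho> \<longleftrightarrow>
     (\<forall>k\<le>n. \<rho> k \<in> extended_boundary T - \<rho> ` {..<k} \<and>
        (\<forall>\<tau> \<in> extended_boundary T - \<rho> ` {..<k}.
           (\<Sum>j<k. common_edges (\<rho> k) (\<rho> j)) \<le> (\<Sum>j<k. common_edges \<tau> (\<rho> j))))"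

definition tree_factorial :: "'v rooted_graph \<Rightarrow> nat \<Rightarrow> nat" where
  "tree_factorial T n =
     (THE m. \<exists>\<rho>. is_tree_ordering T n \<rho> \<and> m = (\<Sum>j<n. common_edges (\<rho> n) (\<rho> j)))"

section \<open>The adelic tree\<close>

definition projection :: "('k::field \<Rightarrow> ereal) \<Rightarrow> nat \<Rightarrow> 'k \<Rightarrow> 'k set" where
  "projection val h x = congruence_mod (valuation_ring val) (maximal_ideal_power val h) `` {x}"

(* The natural map from R modulo the (h+1)-st power of the maximal ideal to R modulo the h-th
   power: on a coset v, all x in v have the same projection, which is the value of the union. *)
definition reduction :: "('k::field \<Rightarrow> ereal) \<Rightarrow> nat \<Rightarrow> 'k set \<Rightarrow> 'k set" where
  "reduction val h v = (\<Union>x\<in>v. projection val h x)"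

(* A vertex carries its level h, which makes the union over h disjoint. *)
definition adelic_vertices :: "('k::field \<Rightarrow> ereal) \<Rightarrow> 'k set \<Rightarrow> (nat \<times> 'k set) set" where
  "adelic_vertices val S = (SIGMA h:UNIV. projection val h ` S)"

definition adelic_parent ::
    "('k::field \<Rightarrow> ereal) \<Rightarrow> 'k set \<Rightarrow> nat \<times> 'k set \<Rightarrow> nat \<times> 'k set \<Rightarrow> bool" where
  "adelic_parent val S u v \<longleftrightarrow> u \<in> adelic_vertices val S \<and> v \<in> adelic_vertices val S \<and>
     fst v = Suc (fst u) \<and> snd u = reduction val (fst u) (snd v)"

definition adelic_tree :: "('k::field \<Rightarrow> ereal) \<Rightarrow> 'k set \<Rightarrow> (nat \<times> 'k set) rooted_graph" where
  "adelic_tree val S =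
     \<lparr>vertices = adelic_vertices val S,
      adjacent = (\<lambda>u v. adelic_parent val S u v \<or> adelic_parent val S v u),
      root = (0, the_elem (projection val 0 ` S))\<rparr>"

end

(* Both factorials come from greedy sequences that minimise the sum of a symmetric ultrametric
   product d (the valuation of a difference, or the number of common edges) with the previous
   terms.  In any such space, if card C = card A + 1, some c in C - A satisfies
   sum_{a in A} d c a <= sum_{x in C - {c}} d c x.  Hence a greedy sequence minimises the total
   energy of its first m points for every m, so that each step has a cost independent of the
   choices.  Sending x in S to the path of its residue classes preserves d, and its image is dense
   in the boundary of the tree; minima over S and over the boundary therefore agree, and every
   S-ordering is a tree ordering of the same cost. *)
theory Submission
  imports Defs
begin

section \<open>Greedy orderings in ultrametric spaces\<close>

definition greedy_ordering :: "('a \<Rightarrow> 'a \<Rightarrow> nat) \<Rightarrow> 'a set \<Rightarrow> nat \<Rightarrow> (nat \<Rightarrow> 'a) \<Rightarrow> bool" where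
  "greedy_ordering d X n s \<longleftrightarrow>
     (\<forall>k\<le>n. s k \<in> X - s ` {..<k} \<and>
        (\<forall>x \<in> X - s ` {..<k}. (\<Sum>j<k. d (s k) (s j)) \<le> (\<Sum>j<k. d x (s j))))"

lemma greedy_ordering_mem: "greedy_ordering d X n s \<Longrightarrow> k \<le> n \<Longrightarrow> s k \<in> X"
  by (simp add: greedy_ordering_def)

lemma greedy_ordering_notin: "greedy_ordering d X n s \<Longrightarrow> k \<le> n \<Longrightarrow> s k \<notin> s ` {..<k}"
  by (simp add: greedy_ordering_def)

lemma greedy_ordering_neq:
  assumes "greedy_ordering d X n s" "j < k" "k \<le> n"
  shows "s k \<noteq> s j"
  using greedy_ordering_notin[OF assms(1,3)] assms(2) by auto

lemma greedy_ordering_min: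
  "greedy_ordering d X n s \<Longrightarrow> k \<le> n \<Longrightarrow> x \<in> X - s ` {..<k} \<Longrightarrow>
     (\<Sum>j<k. d (s k) (s j)) \<le> (\<Sum>j<k. d x (s j))"
  by (simp add: greedy_ordering_def)

lemma greedy_ordering_inj:
  assumes "greedy_ordering d X n s"
  shows "inj_on s {..n}"
proof (rule linorder_inj_onI)
  fix j k assume "j < k" "k \<in> {..n}"
  then show "s j \<noteq> s k" using greedy_ordering_neq[OF assms] by fastforce
qed auto

lemma ex_notin_image_lessThan:
  fixes s :: "nat \<Rightarrow> 'a"
  assumes "finite X \<Longrightarrow> k < card X"
  shows "\<exists>x\<in>X. x \<notin> s ` {..<k}"
proof (rule ccontr)
  assume "\<not> ?thesis"
  then have "X \<subseteq> s ` {..<k}" by auto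
  then have "finite X" "card X \<le> card (s ` {..<k})"
    by (auto intro: finite_subset card_mono)
  moreover have "card (s ` {..<k}) \<le> k" using card_image_le[of "{..<k}" s] by simp
  ultimately show False using assms by simp
qed

lemma ex_greedy_ordering:
  assumes "finite X \<Longrightarrow> n < card X"
  shows "\<exists>s. greedy_ordering d X n s"
  using assms
proof (induction n)
  case 0
  then have "X \<noteq> {}" by auto
  then obtain x where "x \<in> X" by auto
  then have "greedy_ordering d X 0 (\<lambda>_. x)" by (simp add: greedy_ordering_def)
  then show ?case by blast
next
  case (Suc n)
  then obtain s where s: "greedy_ordering d X n s" by fastforce
  obtain y where y: "y \<in> X" "y \<notin> s ` {..<Suc n}"
    using ex_notin_image_lessThan[OF Suc.prems] by blast
  obtain z where z: "z \<in> X - s ` {..<Suc n}"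
    and min: "\<And>x. x \<in> X - s ` {..<Suc n} \<Longrightarrow> (\<Sum>j<Suc n. d z (s j)) \<le> (\<Sum>j<Suc n. d x (s j))"
    using ex_has_least_nat[of "\<lambda>x. x \<in> X - s ` {..<Suc n}" y "\<lambda>x. \<Sum>j<Suc n. d x (s j)"] y
    by blast
  define t where "t = s(Suc n := z)"
  have t: "t j = s j" if "j < Suc n" for j using that by (simp add: t_def)
  have img: "t ` {..<k} = s ` {..<k}" if "k \<le> Suc n" for k using that t by force
  have sum: "(\<Sum>j<k. d x (t j)) = (\<Sum>j<k. d x (s j))" if "k \<le> Suc n" for k x
    using that t by (intro sum.cong) auto
  have "t k \<in> X - t ` {..<k} \<and>
        (\<forall>x \<in> X - t ` {..<k}. (\<Sum>j<k. d (t k) (t j)) \<le> (\<Sum>j<k. d x (t j)))"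
    if k: "k \<le> Suc n" for k
  proof (cases "k = Suc n")
    case True
    then have "t k = z" by (simp add: t_def)
    then show ?thesis unfolding sum[OF k] img[OF k] using z min True by blast
  next
    case False
    with k have k': "k \<le> n" by simp
    then have "t k = s k" by (simp add: t)
    then show ?thesis unfolding sum[OF k] img[OF k]
      using s k' unfolding greedy_ordering_def by simp
  qed
  then have "greedy_ordering d X (Suc n) t" unfolding greedy_ordering_def by blast
  then show ?case by blast
qed

text \<open>Larger values of \<open>d\<close> mean closer points; the values \<open>d x x\<close> play no role.\<close>

locale ultrametric_product =
  fixes d :: "'a \<Rightarrow> 'a \<Rightarrow> nat" and X :: "'a set"
  assumes sym: "x \<in> X \<Longrightarrow> y \<in> X \<Longrightarrow> d x y = d y x"
    and ultra: "x \<in> X \<Longrightarrow> y \<in> X \<Longrightarrow> z \<in> X \<Longrightarrow> x \<noteq> y \<Longrightarrow> y \<noteq> z \<Longrightarrow> x \<noteq> z \<Longrightarrow>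
      min (d x y) (d y z) \<le> d x z"
begin

text \<open>Remove from \<open>A\<close> and \<open>C\<close> a closest pair \<open>a\<close>, \<open>c\<close>; by the ultrametric inequality every
  other point of \<open>C\<close> is at least as close to \<open>c\<close> as to \<open>a\<close>.\<close>

lemma exchange:
  assumes "finite A" "finite C" "A \<subseteq> X" "C \<subseteq> X" "card C = Suc (card A)"
  shows "\<exists>c \<in> C - A. (\<Sum>a\<in>A. d c a) \<le> (\<Sum>x\<in>C - {c}. d c x)"
  using assms
proof (induction "card A" arbitrary: A C)
  case 0
  then have "A = {}" by simp
  moreover obtain c where "c \<in> C" using 0 by fastforce
  ultimately show ?case by auto
next
  case (Suc m)
  then have ne: "A \<noteq> {}" "C \<noteq> {}" by auto
  \<comment> \<open>The induction hypothesis yields \<open>x\<close> outside \<open>A - {a}\<close>;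
    with \<open>x \<noteq> a\<close> it lies outside \<open>A\<close>. If \<open>A\<close> and
    \<open>C\<close> meet, a common point serves as both \<open>a\<close> and
    \<open>c\<close>.\<close>
  have "\<exists>a\<in>A. \<exists>c\<in>C. \<forall>x\<in>C - {c}. x \<notin> A - {a} \<longrightarrow> x \<noteq> a \<and> d x a \<le> d x c"
  proof (cases "A \<inter> C = {}")
    case False
    then show ?thesis by blast
  next
    case True
    define M where "M = Max ((\<lambda>(a, c). d a c) ` (A \<times> C))"
    have fin: "finite ((\<lambda>(a, c). d a c) ` (A \<times> C))" using Suc.prems by simp
    have "M \<in> (\<lambda>(a, c). d a c) ` (A \<times> C)"
      unfolding M_def by (rule Max_in[OF fin]) (use ne in auto)
    then obtain a c where ac: "a \<in> A" "c \<in> C" "d a c = M" by auto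
    have le: "d a' c' \<le> d a c" if "a' \<in> A" "c' \<in> C" for a' c'
      unfolding ac(3) M_def by (rule Max_ge[OF fin]) (use that in auto)
    have "d x a \<le> d x c" if x: "x \<in> C - {c}" for x
    proof -
      have "x \<noteq> a" "a \<noteq> c" "x \<noteq> c" using x ac True by auto
      moreover have "x \<in> X" "a \<in> X" "c \<in> X" using x ac Suc.prems by auto
      ultimately have "min (d x a) (d a c) \<le> d x c" "d x a = d a x"
        using ultra[of x a c] sym by auto
      moreover have "d a x \<le> d a c" using le ac x by auto
      ultimately show ?thesis by linarith
    qed
    then show ?thesis using ac True by blast
  qed
  then obtain a c where a: "a \<in> A" and c: "c \<in> C"
    and *: "\<And>x. x \<in> C - {c} \<Longrightarrow> x \<notin> A - {a} \<Longrightarrow> x \<noteq> a \<and> d x a \<le> d x c" by blast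
  have "\<exists>x \<in> (C - {c}) - (A - {a}). (\<Sum>b\<in>A - {a}. d x b) \<le> (\<Sum>y\<in>(C - {c}) - {x}. d x y)"
    using Suc a c by (intro Suc.hyps(1)) auto
  then obtain x where x: "x \<in> C - {c}" "x \<notin> A - {a}"
    and le: "(\<Sum>b\<in>A - {a}. d x b) \<le> (\<Sum>y\<in>(C - {c}) - {x}. d x y)" by blast
  have "(\<Sum>b\<in>A. d x b) = d x a + (\<Sum>b\<in>A - {a}. d x b)"
    using a Suc.prems by (simp add: sum.remove)
  also have "\<dots> \<le> d x c + (\<Sum>y\<in>(C - {c}) - {x}. d x y)" using le *[OF x] by simp
  also have "(C - {c}) - {x} = (C - {x}) - {c}" by auto
  also have "d x c + (\<Sum>y\<in>(C - {x}) - {c}. d x y) = (\<Sum>y\<in>C - {x}. d x y)"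
    using c x Suc.prems sum.remove[of "C - {x}" c "d x"] by auto
  finally show ?case using x *[OF x] by blast
qed

section \<open>Energies of finite sets and of greedy prefixes\<close>

definition energy :: "'a set \<Rightarrow> nat" where
  "energy C = (\<Sum>x\<in>C. \<Sum>y\<in>C - {x}. d x y)"

text \<open>The energy runs over ordered pairs, so by symmetry each product with the new point
  enters twice.\<close>

lemma energy_insert:
  assumes "finite C" "c \<notin> C" "insert c C \<subseteq> X"
  shows "energy (insert c C) = energy C + 2 * (\<Sum>x\<in>C. d c x)"
proof -
  have "(\<Sum>x\<in>C. \<Sum>y\<in>insert c C - {x}. d x y) = (\<Sum>x\<in>C. d c x + (\<Sum>y\<in>C - {x}. d x y))"
  proof (rule sum.cong)
    fix x assume x: "x \<in> C"
    then have "insert c C - {x} = insert c (C - {x})" using assms by auto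
    then show "(\<Sum>y\<in>insert c C - {x}. d x y) = d c x + (\<Sum>y\<in>C - {x}. d x y)"
      using assms x sym[of x c] by auto
  qed simp
  then have 1: "(\<Sum>x\<in>C. \<Sum>y\<in>insert c C - {x}. d x y) = (\<Sum>x\<in>C. d c x) + energy C"
    by (simp add: sum.distrib energy_def)
  have "insert c C - {c} = C" using assms by auto
  then show ?thesis using assms 1 by (simp add: energy_def)
qed

lemma energy_greedy_ordering:
  assumes "greedy_ordering d X n s" "m \<le> n"
  shows "energy (s ` {..<Suc m}) = energy (s ` {..<m}) + 2 * (\<Sum>j<m. d (s m) (s j))"
proof -
  have "energy (insert (s m) (s ` {..<m})) = energy (s ` {..<m}) + 2 * (\<Sum>x\<in>s ` {..<m}. d (s m) x)"
    using greedy_ordering_mem[OF assms(1)] greedy_ordering_notin[OF assms] assms(2)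
    by (intro energy_insert) auto
  moreover have "(\<Sum>x\<in>s ` {..<m}. d (s m) x) = (\<Sum>j<m. d (s m) (s j))"
    using inj_on_subset[OF greedy_ordering_inj[OF assms(1)], of "{..<m}"] assms(2)
    by (subst sum.reindex) (auto simp: subset_iff)
  ultimately show ?thesis by (simp add: lessThan_Suc)
qed

text \<open>Induction on \<open>m\<close>. \<open>exchange\<close> supplies \<open>c\<close> in
  \<open>C\<close> outside the greedy prefix whose cost against the prefix is at most its cost
  against \<open>C - {c}\<close>; the greedy choice costs no more than \<open>c\<close>, and the
  induction hypothesis handles \<open>C - {c}\<close>.\<close>

lemma energy_greedy_ordering_le:
  assumes "greedy_ordering d X n s" "m \<le> Suc n" "finite C" "C \<subseteq> X" "card C = m"
  shows "energy (s ` {..<m}) \<le> energy C"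
  using assms
proof (induction m arbitrary: C)
  case 0
  then show ?case by (simp add: energy_def)
next
  case (Suc m)
  have inj: "inj_on s {..<m}"
    by (rule inj_on_subset[OF greedy_ordering_inj[OF Suc.prems(1)]]) (use Suc.prems(2) in auto)
  have sub: "s ` {..<m} \<subseteq> X" using greedy_ordering_mem[OF Suc.prems(1)] Suc.prems(2) by auto
  obtain c where c: "c \<in> C" "c \<notin> s ` {..<m}"
    and le: "(\<Sum>a\<in>s ` {..<m}. d c a) \<le> (\<Sum>x\<in>C - {c}. d c x)"
    using exchange[of "s ` {..<m}" C] Suc.prems inj sub by (auto simp: card_image)
  have "(\<Sum>j<m. d (s m) (s j)) \<le> (\<Sum>j<m. d c (s j))"
    using Suc.prems c by (intro greedy_ordering_min[OF Suc.prems(1)]) auto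
  also have "\<dots> = (\<Sum>a\<in>s ` {..<m}. d c a)" using inj by (simp add: sum.reindex)
  also note le
  finally have 1: "(\<Sum>j<m. d (s m) (s j)) \<le> (\<Sum>x\<in>C - {c}. d c x)" .
  have "energy (s ` {..<m}) \<le> energy (C - {c})"
    using Suc c by (intro Suc.IH) auto
  moreover have "energy C = energy (C - {c}) + 2 * (\<Sum>x\<in>C - {c}. d c x)"
    using energy_insert[of "C - {c}" c] Suc.prems c by (simp add: insert_absorb)
  moreover have "energy (s ` {..<Suc m}) = energy (s ` {..<m}) + 2 * (\<Sum>j<m. d (s m) (s j))"
    using Suc.prems by (intro energy_greedy_ordering) auto
  ultimately show ?case using 1 by simp
qed

lemma energy_greedy_ordering_unique:
  assumes "greedy_ordering d X n s" "greedy_ordering d X n t" "m \<le> Suc n"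
  shows "energy (s ` {..<m}) = energy (t ` {..<m})"
proof -
  have *: "energy (s ` {..<m}) \<le> energy (t ` {..<m})"
    if "greedy_ordering d X n s" "greedy_ordering d X n t" for s t
  proof (rule energy_greedy_ordering_le[OF that(1) assms(3)])
    have "inj_on t {..<m}"
      by (rule inj_on_subset[OF greedy_ordering_inj[OF that(2)]]) (use assms(3) in auto)
    then show "card (t ` {..<m}) = m" by (simp add: card_image)
    show "t ` {..<m} \<subseteq> X" using greedy_ordering_mem[OF that(2)] assms(3) by auto
  qed simp
  show ?thesis using *[OF assms(1,2)] *[OF assms(2,1)] by simp
qed

text \<open>The cost of step \<open>n\<close> is half the difference of the energies of two
  successive prefixes, and these energies do not depend on the choices.\<close>

theorem greedy_ordering_unique:
  assumes "greedy_ordering d X n s" "greedy_ordering d X n t"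
  shows "(\<Sum>j<n. d (s n) (s j)) = (\<Sum>j<n. d (t n) (t j))"
  using energy_greedy_ordering_unique[OF assms, of n] energy_greedy_ordering_unique[OF assms, of "Suc n"]
    energy_greedy_ordering[OF assms(1), of n] energy_greedy_ordering[OF assms(2), of n] by simp

end

section \<open>Discrete valuations\<close>

context nonarch_local_field
begin

lemma val_of_nonzero: "x \<noteq> 0 \<Longrightarrow> \<exists>i::int. val x = ereal (of_int i)"
  using val_range by blast

lemma val_one: "val 1 = 0"
  using val_mult[of 1 1] val_of_nonzero[of 1] by auto

text \<open>\<open>val (-1)\<close> is a finite number whose double is
  \<open>val 1 = 0\<close>.\<close>

lemma val_minus: "val (- x) = val x"
proof -
  obtain i where i: "val (-1) = ereal (of_int i)" using val_of_nonzero[of "-1"] by auto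
  have "val ((-1) * (-1)) = val (-1) + val (-1)" by (rule val_mult)
  then have "val (-1) = 0" using i val_one by (simp add: zero_ereal_def)
  then show ?thesis using val_mult[of "-1" x] by simp
qed

lemma val_minus_commute: "val (x - y) = val (y - x)"
  using val_minus[of "x - y"] by simp

lemma val_sum_ge:
  assumes "\<And>i. i < n \<Longrightarrow> c \<le> val (f i)"
  shows "c \<le> val (\<Sum>i<(n::nat). f i)"
  using assms
proof (induction n)
  case (Suc n)
  then have "c \<le> val (\<Sum>i<n. f i)" "c \<le> val (f n)" by auto
  then have "c \<le> min (val (\<Sum>i<n. f i)) (val (f n))" by simp
  also note val_add
  finally show ?case by simp
qed (simp add: val_zero)

lemma val_diff_ge: "c \<le> val (x - y) \<Longrightarrow> c \<le> val (y - z) \<Longrightarrow> c \<le> val (x - z)"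
  using val_add[of "x - y" "y - z"] by (simp add: min_def split: if_splits)

lemma val_diff_ge_zero: "x \<in> valuation_ring val \<Longrightarrow> y \<in> valuation_ring val \<Longrightarrow> 0 \<le> val (x - y)"
  using val_diff_ge[of 0 x 0 y] by (simp add: valuation_ring_def val_minus)

lemma ex_uniformizer: "\<exists>p. p \<noteq> 0 \<and> val p = 1"
proof -
  have "ereal (of_int 1) \<in> val ` (UNIV - {0})" unfolding val_range by blast
  then show ?thesis by (force simp: one_ereal_def)
qed

text \<open>Induction on \<open>h\<close>: multiplying by an element of the maximal ideal raises the
  valuation by at least 1, finite valuations being integers, and dividing by a uniformizer lowers it
  by exactly 1.\<close>

lemma maximal_ideal_power_eq: "maximal_ideal_power val h = {x. ereal (real h) \<le> val x}"
proof (induction h)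
  case 0
  show ?case by (simp add: valuation_ring_def zero_ereal_def)
next
  case (Suc h)
  have "x \<in> ideal_product (maximal_ideal val) (maximal_ideal_power val h)
      \<longleftrightarrow> ereal (real (Suc h)) \<le> val x" for x
  proof
    assume "x \<in> ideal_product (maximal_ideal val) (maximal_ideal_power val h)"
    then obtain n a b where x: "x = (\<Sum>i<(n::nat). a i * b i)"
      and a: "\<And>i. i < n \<Longrightarrow> 0 < val (a i)" and b: "\<And>i. i < n \<Longrightarrow> ereal (real h) \<le> val (b i)"
      unfolding ideal_product_def Suc maximal_ideal_def by blast
    have "ereal (real (Suc h)) \<le> val (a i * b i)" if i: "i < n" for i
    proof -
      have "1 \<le> val (a i)"
      proof (cases "a i = 0")
        case False
        then obtain k where "val (a i) = ereal (of_int k)" using val_of_nonzero by blast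
        then show ?thesis using a[OF i] by (auto simp: zero_ereal_def one_ereal_def)
      qed (simp add: val_zero)
      then have "1 + ereal (real h) \<le> val (a i) + val (b i)" using b[OF i] by (rule add_mono)
      then show ?thesis by (simp add: val_mult one_ereal_def)
    qed
    then show "ereal (real (Suc h)) \<le> val x" unfolding x by (rule val_sum_ge)
  next
    assume x: "ereal (real (Suc h)) \<le> val x"
    obtain p where p: "p \<noteq> 0" "val p = 1" using ex_uniformizer by blast
    have "val x = 1 + val (x / p)" using val_mult[of p "x / p"] p by simp
    then have "ereal (real h) \<le> val (x / p)" using x
      by (cases "val (x / p)") (auto simp: one_ereal_def)
    moreover have "x = (\<Sum>i<(1::nat). p * (x / p))" using p by simp
    moreover have "0 < val p" using p by simp
    ultimately show "x \<in> ideal_product (maximal_ideal val) (maximal_ideal_power val h)"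
      unfolding ideal_product_def Suc maximal_ideal_def mem_Collect_eq
      by (intro exI[of _ "1::nat"] exI[of _ "\<lambda>_. p"] exI[of _ "\<lambda>_. x / p"]) blast
  qed
  then show ?case by auto
qed

section \<open>Residue classes as valuation balls\<close>

lemma projection_eq:
  assumes "x \<in> valuation_ring val"
  shows "projection val h x = {y \<in> valuation_ring val. ereal (real h) \<le> val (x - y)}"
  using assms by (auto simp: projection_def congruence_mod_def maximal_ideal_power_eq)

lemma mem_projection: "x \<in> valuation_ring val \<Longrightarrow> x \<in> projection val h x"
  by (simp add: projection_eq val_zero)

text \<open>A class is a ball of the ultrametric, and two balls of equal radius that meet
  coincide.\<close>

lemma projection_eq_iff:
  assumes "x \<in> valuation_ring val" "y \<in> valuation_ring val"
  shows "projection val h x = projection val h y \<longleftrightarrow> ereal (real h) \<le> val (x - y)"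
proof
  assume "projection val h x = projection val h y"
  then have "y \<in> projection val h x" using mem_projection[OF assms(2)] by simp
  then show "ereal (real h) \<le> val (x - y)" using assms by (simp add: projection_eq)
next
  assume *: "ereal (real h) \<le> val (x - y)"
  have "ereal (real h) \<le> val (x - z) \<longleftrightarrow> ereal (real h) \<le> val (y - z)" for z
    using val_diff_ge[of _ y x z] val_diff_ge[of _ x y z] * val_minus_commute[of x y] by auto
  then show "projection val h x = projection val h y" using assms by (simp add: projection_eq)
qed

lemma projection_zero:
  assumes "x \<in> valuation_ring val"
  shows "projection val 0 x = valuation_ring val"
  using val_diff_ge_zero[OF assms] by (auto simp: projection_eq[OF assms] zero_ereal_def)

text \<open>Elements congruent modulo the higher power are congruent modulo the lower one, so all
  sets in the union defining \<open>reduction\<close> are equal, and \<open>x\<close> itself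
  contributes one.\<close>

lemma reduction_projection:
  assumes x: "x \<in> valuation_ring val"
  shows "reduction val h (projection val (Suc h) x) = projection val h x"
proof -
  have "projection val h y = projection val h x" if y: "y \<in> projection val (Suc h) x" for y
  proof -
    have "y \<in> valuation_ring val" "ereal (real (Suc h)) \<le> val (x - y)"
      using y x by (auto simp: projection_eq)
    moreover have "ereal (real h) \<le> ereal (real (Suc h))" by simp
    ultimately show ?thesis using x projection_eq_iff[of x y] order_trans by metis
  qed
  then show ?thesis unfolding reduction_def using mem_projection[OF x] by blast
qed

text \<open>Turns valuations of products into sums in \<open>nat\<close>, for nonzero elements of
  the valuation ring. At 0 its value is 0, not infinity, so repeated points must be treated
  apart.\<close>

definition nat_val :: "'k \<Rightarrow> nat" where
  "nat_val x = nat \<lfloor>real_of_ereal (val x)\<rfloor>"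

lemma val_eq_nat_val:
  assumes "x \<noteq> 0" "0 \<le> val x"
  shows "val x = ereal (real (nat_val x))"
  using val_of_nonzero[OF assms(1)] assms(2) by (auto simp: nat_val_def zero_ereal_def)

lemma val_prod:
  assumes "\<And>j. j < (k::nat) \<Longrightarrow> f j \<noteq> 0 \<and> 0 \<le> val (f j)"
  shows "val (\<Prod>j<k. f j) = ereal (real (\<Sum>j<k. nat_val (f j)))"
  using assms
proof (induction k)
  case 0
  show ?case by (simp add: val_one zero_ereal_def)
next
  case (Suc k)
  then show ?case using val_eq_nat_val[of "f k"] by (simp add: val_mult)
qed

end

section \<open>The boundary of the adelic tree\<close>

locale adelic = nonarch_local_field val for val :: "'k::field \<Rightarrow> ereal" +
  fixes S :: "'k set"
  assumes S_subset: "S \<subseteq> valuation_ring val" and S_nonempty: "S \<noteq> {}"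
begin

section \<open>Vertices, edges and leaves of the adelic tree\<close>

abbreviation T :: "(nat \<times> 'k set) rooted_graph" where "T \<equiv> adelic_tree val S"

definition vertex :: "nat \<Rightarrow> 'k \<Rightarrow> nat \<times> 'k set" where
  "vertex h x = (h, projection val h x)"

lemma fst_vertex [simp]: "fst (vertex h x) = h"
  by (simp add: vertex_def)

lemma S_ring: "x \<in> S \<Longrightarrow> x \<in> valuation_ring val"
  using S_subset by auto

lemma vertices_T: "vertices T = {vertex h x | h x. x \<in> S}"
  by (auto simp: adelic_tree_def adelic_vertices_def vertex_def)

lemma root_T:
  assumes "x \<in> S"
  shows "root T = vertex 0 x"
proof -
  have "projection val 0 ` S = {valuation_ring val}"
    using S_nonempty S_ring projection_zero by auto
  then show ?thesis using projection_zero[OF S_ring[OF assms]]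
    by (simp add: adelic_tree_def vertex_def)
qed

text \<open>Reduction keeps representatives, so a representative of the deeper endpoint of an edge
  also represents the other one.\<close>

lemma adelic_parent_iff:
  "adelic_parent val S u v \<longleftrightarrow> (\<exists>h. \<exists>x\<in>S. u = vertex h x \<and> v = vertex (Suc h) x)"
proof
  assume p: "adelic_parent val S u v"
  then obtain x where "x \<in> S" "v = vertex (Suc (fst u)) x"
    by (cases v) (auto simp: adelic_parent_def adelic_vertices_def vertex_def)
  moreover from this p have "u = vertex (fst u) x"
    using reduction_projection[OF S_ring]
    by (cases u) (auto simp: adelic_parent_def vertex_def)
  ultimately show "\<exists>h. \<exists>x\<in>S. u = vertex h x \<and> v = vertex (Suc h) x" by blast
next
  assume "\<exists>h. \<exists>x\<in>S. u = vertex h x \<and> v = vertex (Suc h) x"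
  then show "adelic_parent val S u v" using reduction_projection[OF S_ring]
    by (auto simp: adelic_parent_def vertex_def adelic_vertices_def)
qed

lemma adjacent_T: "adjacent T u v \<longleftrightarrow> adelic_parent val S u v \<or> adelic_parent val S v u"
  by (simp add: adelic_tree_def)

text \<open>The classes of \<open>x\<close> at levels 0 to \<open>h\<close> form a walk of length
  \<open>h\<close>. A shorter walk cannot arrive, since each edge changes the level by one.\<close>

lemma depth_vertex:
  assumes x: "x \<in> S"
  shows "depth T (vertex h x) = h"
  unfolding depth_def
proof (rule Least_equality)
  show "(root T, vertex h x) \<in> {(x, y). adjacent T x y} ^^ h"
  proof (induction h)
    case 0
    show ?case by (simp add: root_T[OF x])
  next
    case (Suc h)
    then show ?case using x by (auto simp: adjacent_T adelic_parent_iff intro!: relcompI)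
  qed
  fix n
  have "fst v \<le> n" if "(root T, v) \<in> {(x, y). adjacent T x y} ^^ n" for v
    using that
  proof (induction n arbitrary: v)
    case 0
    then show ?case using root_T[OF x] by auto
  next
    case (Suc n)
    then obtain u where "(root T, u) \<in> {(x, y). adjacent T x y} ^^ n" "adjacent T u v" by auto
    then have "fst u \<le> n" "adjacent T u v" using Suc.IH by auto
    then show ?case by (auto simp: adjacent_T adelic_parent_iff)
  qed
  then show "(root T, vertex h x) \<in> {(x, y). adjacent T x y} ^^ n \<Longrightarrow> h \<le> n" by fastforce
qed

lemma oriented_edge_T: "oriented_edge T u v \<longleftrightarrow> adelic_parent val S u v"
  unfolding oriented_edge_def adjacent_T adelic_parent_iff
  using depth_vertex by fastforce

text \<open>Every vertex has a child, and a vertex other than the root also has a parent, so its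
  valence is at least two. Hence the boundary has only infinite paths, even for finite
  \<open>S\<close>.\<close>

lemma not_leaf_T: "\<not> leaf T v"
proof
  assume l: "leaf T v"
  then obtain h x where v: "v = vertex h x" "x \<in> S" by (auto simp: leaf_def vertices_T)
  have "vertex 1 x \<in> vertices T" using v by (auto simp: vertices_T)
  moreover have "vertex 1 x \<noteq> root T" using root_T[OF v(2)] by (simp add: vertex_def)
  ultimately have "v \<noteq> root T" "card {u. adjacent T v u} = 1" using l by (auto simp: leaf_def)
  moreover from this obtain h' where "h = Suc h'" using v root_T by (cases h) auto
  ultimately obtain w where w: "{u. adjacent T v u} = {w}" using card_1_singletonE by blast
  have "adjacent T v (vertex (Suc h) x)" "adjacent T v (vertex h' x)"
    using v \<open>h = Suc h'\<close> by (auto simp: adjacent_T adelic_parent_iff)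
  then have "vertex (Suc h) x = vertex h' x" using w by (metis mem_Collect_eq singletonD)
  then show False using \<open>h = Suc h'\<close> by (simp add: vertex_def)
qed

section \<open>Boundary paths and their initial segments\<close>

definition boundary_point :: "'k \<Rightarrow> (nat \<times> 'k set) path" where
  "boundary_point x = Infinite_Path (\<lambda>h. vertex h x)"

lemma extended_boundary_T:
  "extended_boundary T =
     {Infinite_Path p | p. p 0 = root T \<and> (\<forall>i. adelic_parent val S (p i) (p (Suc i)))}"
  by (simp add: extended_boundary_def not_leaf_T oriented_edge_T)

lemma boundary_point_mem: "x \<in> S \<Longrightarrow> boundary_point x \<in> extended_boundary T"
  by (auto simp: extended_boundary_T boundary_point_def adelic_parent_iff root_T)

lemma boundary_fst:
  assumes "Infinite_Path p \<in> extended_boundary T"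
  shows "fst (p i) = i"
proof (induction i)
  case 0
  have "p 0 = root T" using assms by (auto simp: extended_boundary_T)
  then show ?case using S_nonempty root_T by fastforce
next
  case (Suc i)
  have "adelic_parent val S (p i) (p (Suc i))" using assms by (auto simp: extended_boundary_T)
  then show ?case using Suc by (simp add: adelic_parent_def)
qed

text \<open>A representative of the vertex at level \<open>h\<close> determines, by reduction, every
  vertex nearer the root. It may change with \<open>h\<close>, since the path need not come from a
  single point of \<open>S\<close>.\<close>

lemma boundary_vertices:
  assumes "Infinite_Path p \<in> extended_boundary T"
  shows "\<exists>x\<in>S. \<forall>i\<le>h. p i = vertex i x"
proof -
  have p: "adelic_parent val S (p i) (p (Suc i))" for i
    using assms by (auto simp: extended_boundary_T)
  have down: "p i = vertex i x" if "x \<in> S" "p (Suc i) = vertex (Suc i) x" for i x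
  proof -
    from p[of i] have "snd (p i) = reduction val i (snd (vertex (Suc i) x))"
      using that boundary_fst[OF assms] by (simp add: adelic_parent_def)
    then show ?thesis using boundary_fst[OF assms, of i] reduction_projection[OF S_ring[OF that(1)]]
      by (simp add: vertex_def prod_eq_iff)
  qed
  obtain x h' where "x \<in> S" "p h = vertex h' x"
    using p[of h] unfolding adelic_parent_iff by blast
  then have x: "x \<in> S" "p h = vertex h x" using boundary_fst[OF assms, of h] by auto
  have "p i = vertex i x" if "i \<le> h" for i
    using that by (induction rule: inc_induct) (rule x(2), rule down[OF x(1)])
  with x show ?thesis by blast
qed

lemma boundary_agree_mono:
  assumes "Infinite_Path p \<in> extended_boundary T" "Infinite_Path q \<in> extended_boundary T"
    and "p h = q h" "i \<le> h"
  shows "p i = q i"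
proof -
  obtain x where x: "x \<in> S" "\<And>i. i \<le> h \<Longrightarrow> p i = vertex i x"
    using boundary_vertices[OF assms(1), of h] by blast
  obtain y where y: "y \<in> S" "\<And>i. i \<le> h \<Longrightarrow> q i = vertex i y"
    using boundary_vertices[OF assms(2), of h] by blast
  have *: "ereal (real h) \<le> val (x - y)"
    using x(2)[of h] y(2)[of h] assms(3) projection_eq_iff[OF S_ring S_ring, OF x(1) y(1), of h]
    by (simp add: vertex_def)
  have "ereal (real i) \<le> val (x - y)" by (rule order_trans[OF _ *]) (use assms(4) in simp)
  then show ?thesis
    using x(2)[of i] y(2)[of i] assms(4) projection_eq_iff[OF S_ring S_ring, OF x(1) y(1), of i]
    by (simp add: vertex_def)
qed

section \<open>Common edges as an ultrametric product\<close>

lemma common_edges_card: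
  assumes p: "Infinite_Path p \<in> extended_boundary T" and q: "Infinite_Path q \<in> extended_boundary T"
  shows "common_edges (Infinite_Path p) (Infinite_Path q) = card {i. p (Suc i) = q (Suc i)}"
proof -
  note fst = boundary_fst[OF p] boundary_fst[OF q]
  \<comment> \<open>Levels force a common edge to have the same index in both paths, and agreement
    at its deeper end forces agreement at the other.\<close>
  have "path_edges (Infinite_Path p) \<inter> path_edges (Infinite_Path q)
      = (\<lambda>i. (p i, p (Suc i))) ` {i. p (Suc i) = q (Suc i)}" (is "?L = ?R")
  proof
    show "?L \<subseteq> ?R"
    proof
      fix e assume "e \<in> ?L"
      then have "\<exists>i. e = (p i, p (Suc i))" "\<exists>j. e = (q j, q (Suc j))" by simp_all
      then obtain i j where e: "e = (p i, p (Suc i))" "e = (q j, q (Suc j))" by blast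
      then have "i = j" using fst(1)[of i] fst(2)[of j] by simp
      with e show "e \<in> ?R" by auto
    qed
    show "?R \<subseteq> ?L"
    proof
      fix e assume "e \<in> ?R"
      then obtain i where e: "e = (p i, p (Suc i))" "p (Suc i) = q (Suc i)" by blast
      moreover have "p i = q i" using boundary_agree_mono[OF p q e(2)] by simp
      ultimately have "e = (p i, p (Suc i))" "e = (q i, q (Suc i))" by simp_all
      then show "e \<in> ?L" unfolding path_edges.simps by blast
    qed
  qed
  moreover have "inj (\<lambda>i. (p i, p (Suc i)))"
    by (rule injI) (metis fst(1) prod.inject)
  ultimately show ?thesis unfolding common_edges_def
    by (simp only: card_image[OF inj_on_subset[OF _ subset_UNIV]])
qed

text \<open>Distinct paths agree exactly up to their first disagreement. Distinctness matters: equal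
  paths share infinitely many edges, and \<open>card\<close> then gives 0.\<close>

lemma le_common_edges_iff:
  assumes p: "Infinite_Path p \<in> extended_boundary T" and q: "Infinite_Path q \<in> extended_boundary T"
    and "p \<noteq> q"
  shows "h \<le> common_edges (Infinite_Path p) (Infinite_Path q) \<longleftrightarrow> p h = q h"
proof -
  have mono: "p i = q i" if "p j = q j" "i \<le> j" for i j
    using boundary_agree_mono[OF p q] that by blast
  obtain k where k: "p k \<noteq> q k" using \<open>p \<noteq> q\<close> by blast
  define m where "m = (LEAST k. p k \<noteq> q k)"
  have m: "p m \<noteq> q m" unfolding m_def by (rule LeastI[of _ k]) (rule k)
  have agree: "p i = q i \<longleftrightarrow> i < m" for i
  proof
    show "i < m" if "p i = q i" using m mono[OF that] by (rule contrapos_np) simp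
    show "p i = q i" if "i < m" using not_less_Least[OF that[unfolded m_def]] by simp
  qed
  have "p 0 = q 0" using p q by (auto simp: extended_boundary_T)
  \<comment> \<open>The shared root makes \<open>m\<close> positive; the \<open>m\<close> common
    vertices are joined by \<open>m' = m - 1\<close> common edges.\<close>
  then obtain m' where m': "m = Suc m'" using agree by (cases m) auto
  have "{i. p (Suc i) = q (Suc i)} = {..<m'}" unfolding agree m' by auto
  then have "common_edges (Infinite_Path p) (Infinite_Path q) = m'"
    using common_edges_card[OF p q] by simp
  then show ?thesis by (simp add: agree m' less_Suc_eq_le)
qed

text \<open>By \<open>le_common_edges_iff\<close>, sharing at least \<open>h\<close> edges means
  having the same vertex at level \<open>h\<close>, a transitive relation.\<close>

lemma boundary_ultrametric: "ultrametric_product common_edges (extended_boundary T)"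
proof (rule ultrametric_product.intro)
  fix \<rho> \<tau> :: "(nat \<times> 'k set) path"
  show "common_edges \<rho> \<tau> = common_edges \<tau> \<rho>" by (simp add: common_edges_def Int_commute)
next
  fix \<rho> \<sigma> \<tau>
  assume mem: "\<rho> \<in> extended_boundary T" "\<sigma> \<in> extended_boundary T" "\<tau> \<in> extended_boundary T"
    and ne: "\<rho> \<noteq> \<sigma>" "\<sigma> \<noteq> \<tau>" "\<rho> \<noteq> \<tau>"
  obtain p q r where eq: "\<rho> = Infinite_Path p" "\<sigma> = Infinite_Path q" "\<tau> = Infinite_Path r"
    using mem unfolding extended_boundary_T by blast
  define h where "h = min (common_edges \<rho> \<sigma>) (common_edges \<sigma> \<tau>)"
  have "h \<le> common_edges \<rho> \<sigma>" "h \<le> common_edges \<sigma> \<tau>" by (simp_all add: h_def)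
  then have "p h = q h" "q h = r h"
    using le_common_edges_iff[of p q h] le_common_edges_iff[of q r h] mem ne unfolding eq by simp_all
  then show "h \<le> common_edges \<rho> \<tau>"
    using le_common_edges_iff[of p r h] mem ne unfolding eq by simp
qed

text \<open>Both quantities have the same lower bounds: \<open>h\<close> is one exactly when
  \<open>x\<close> and \<open>y\<close> are congruent modulo the \<open>h\<close>-th power of the
  maximal ideal.\<close>

lemma common_edges_boundary_point:
  assumes "x \<in> S" "y \<in> S" "x \<noteq> y"
  shows "boundary_point x \<noteq> boundary_point y"
    and "common_edges (boundary_point x) (boundary_point y) = nat_val (x - y)"
proof -
  have v: "val (x - y) = ereal (real (nat_val (x - y)))"
    using assms by (intro val_eq_nat_val val_diff_ge_zero S_ring) auto
  have iff: "vertex h x = vertex h y \<longleftrightarrow> h \<le> nat_val (x - y)" for h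
    using projection_eq_iff[OF S_ring S_ring, OF assms(1,2)] v by (simp add: vertex_def)
  have ne: "(\<lambda>h. vertex h x) \<noteq> (\<lambda>h. vertex h y)"
    using iff[of "Suc (nat_val (x - y))"] by (auto dest: fun_cong)
  then show "boundary_point x \<noteq> boundary_point y" by (simp add: boundary_point_def)
  have "h \<le> common_edges (boundary_point x) (boundary_point y) \<longleftrightarrow> h \<le> nat_val (x - y)" for h
    using le_common_edges_iff[OF _ _ ne] boundary_point_mem assms iff
    by (simp add: boundary_point_def)
  then show "common_edges (boundary_point x) (boundary_point y) = nat_val (x - y)"
    by (metis order_antisym order_refl)
qed

text \<open>Any element of \<open>S\<close> representing the vertex of \<open>\<tau>\<close> at
  level \<open>h\<close> is close enough. Equality is a separate alternative because
  \<open>common_edges \<tau> \<tau>\<close> is 0.\<close>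

lemma boundary_point_dense:
  assumes "\<tau> \<in> extended_boundary T"
  shows "\<exists>x\<in>S. boundary_point x = \<tau> \<or> h \<le> common_edges \<tau> (boundary_point x)"
proof -
  obtain p where p: "\<tau> = Infinite_Path p"
    using assms unfolding extended_boundary_T by blast
  then obtain x where x: "x \<in> S" "p h = vertex h x"
    using boundary_vertices[of p h] assms by blast
  then show ?thesis
    using le_common_edges_iff[of p "\<lambda>h. vertex h x"] boundary_point_mem[of x] assms p
    by (auto simp: boundary_point_def)
qed

section \<open>Comparison of the two factorials\<close>

lemma is_tree_ordering_iff: "is_tree_ordering T = greedy_ordering common_edges (extended_boundary T)"
  by (simp add: is_tree_ordering_def greedy_ordering_def fun_eq_iff)

lemma val_prod_diff:
  assumes "s ` {..<(k::nat)} \<subseteq> S" "x \<in> S" "x \<notin> s ` {..<k}"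
  shows "val (\<Prod>j<k. x - s j) = ereal (real (\<Sum>j<k. nat_val (x - s j)))"
proof (rule val_prod)
  fix j assume "j < k"
  then show "x - s j \<noteq> 0 \<and> 0 \<le> val (x - s j)"
    using assms by (intro conjI val_diff_ge_zero S_ring) auto
qed

lemma val_prod_diff_infinite:
  assumes "x \<in> s ` {..<(k::nat)}"
  shows "val (\<Prod>j<k. x - s j) = \<infinity>"
proof -
  have "(\<Prod>j<k. x - s j) = 0" using assms by (auto intro: prod_zero)
  then show ?thesis by (simp only: val_zero)
qed

lemma is_S_ordering_iff:
  assumes "finite S \<Longrightarrow> n < card S"
  shows "is_S_ordering val S n s = greedy_ordering (\<lambda>x y. nat_val (x - y)) S n s"
proof
  assume s: "is_S_ordering val S n s"
  show "greedy_ordering (\<lambda>x y. nat_val (x - y)) S n s"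
    unfolding greedy_ordering_def
  proof (intro allI impI)
    fix k assume k: "k \<le> n"
    have sub: "s ` {..<k} \<subseteq> S" and mem: "s k \<in> S" using s k by (auto simp: is_S_ordering_def)
    have min: "val (\<Prod>j<k. s k - s j) \<le> val (\<Prod>j<k. x - s j)" if "x \<in> S" for x
      using s k that by (auto simp: is_S_ordering_def)
    have "\<exists>y\<in>S. y \<notin> s ` {..<k}"
      by (rule ex_notin_image_lessThan) (use assms k in fastforce)
    then obtain y where y: "y \<in> S" "y \<notin> s ` {..<k}" by blast
    have new: "s k \<notin> s ` {..<k}"
    proof
      assume "s k \<in> s ` {..<k}"
      then have "val (\<Prod>j<k. s k - s j) = \<infinity>" by (rule val_prod_diff_infinite)
      then show False using min[OF y(1)] val_prod_diff[OF sub y] by simp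
    qed
    have "(\<Sum>j<k. nat_val (s k - s j)) \<le> (\<Sum>j<k. nat_val (x - s j))" if "x \<in> S - s ` {..<k}" for x
    proof -
      have "ereal (real (\<Sum>j<k. nat_val (s k - s j))) \<le> ereal (real (\<Sum>j<k. nat_val (x - s j)))"
        using min[of x] val_prod_diff[OF sub mem new] val_prod_diff[OF sub, of x] that by auto
      then show ?thesis by (simp only: ereal_less_eq of_nat_le_iff)
    qed
    then show "s k \<in> S - s ` {..<k} \<and> (\<forall>x\<in>S - s ` {..<k}.
        (\<Sum>j<k. nat_val (s k - s j)) \<le> (\<Sum>j<k. nat_val (x - s j)))"
      using mem new by blast
  qed
next
  assume s: "greedy_ordering (\<lambda>x y. nat_val (x - y)) S n s"
  show "is_S_ordering val S n s"
    unfolding is_S_ordering_def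
  proof (intro allI impI conjI ballI)
    fix k assume k: "k \<le> n"
    show mem: "s k \<in> S" using greedy_ordering_mem[OF s k] .
    have sub: "s ` {..<k} \<subseteq> S" using greedy_ordering_mem[OF s] k by auto
    fix x assume x: "x \<in> S"
    show "val (\<Prod>j<k. s k - s j) \<le> val (\<Prod>j<k. x - s j)"
    proof (cases "x \<in> s ` {..<k}")
      case True
      then show ?thesis by (simp only: val_prod_diff_infinite ereal_less_eq)
    next
      case False
      then have "(\<Sum>j<k. nat_val (s k - s j)) \<le> (\<Sum>j<k. nat_val (x - s j))"
        using greedy_ordering_min[OF s k] x by blast
      then show ?thesis
        unfolding val_prod_diff[OF sub mem greedy_ordering_notin[OF s k]] val_prod_diff[OF sub x False]
        by (simp only: ereal_less_eq of_nat_le_iff)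
    qed
  qed
qed

lemma sum_common_edges_boundary_point:
  assumes "x \<in> S" "s ` {..<k} \<subseteq> S" "x \<notin> s ` {..<(k::nat)}"
  shows "(\<Sum>j<k. common_edges (boundary_point x) (boundary_point (s j)))
    = (\<Sum>j<k. nat_val (x - s j))"
  using assms by (intro sum.cong common_edges_boundary_point(2)) auto

text \<open>The new competitors are paths not coming from \<open>S\<close>. Each is replaced by a
  point of \<open>S\<close> closer to it than all previous terms, which costs no more.\<close>

lemma greedy_ordering_boundary_point:
  assumes s: "greedy_ordering (\<lambda>x y. nat_val (x - y)) S n s"
  shows "greedy_ordering common_edges (extended_boundary T) n (\<lambda>k. boundary_point (s k))"
  unfolding greedy_ordering_def
proof (intro allI impI conjI ballI)
  interpret ultrametric_product common_edges "extended_boundary T"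
    by (rule boundary_ultrametric)
  fix k assume k: "k \<le> n"
  have mem: "s j \<in> S" if "j \<le> k" for j using greedy_ordering_mem[OF s] that k by auto
  have sub: "s ` {..<k} \<subseteq> S" using mem by auto
  have new: "s k \<notin> s ` {..<k}" using greedy_ordering_notin[OF s k] .
  have "boundary_point (s k) \<noteq> boundary_point (s j)" if "j < k" for j
    using that mem[of k] mem[of j] new by (intro common_edges_boundary_point(1)) auto
  then show "boundary_point (s k) \<in> extended_boundary T - (\<lambda>k. boundary_point (s k)) ` {..<k}"
    using boundary_point_mem[OF mem[of k]] by auto
  fix \<tau> assume \<tau>: "\<tau> \<in> extended_boundary T - (\<lambda>k. boundary_point (s k)) ` {..<k}"
  \<comment> \<open>This level exceeds every single product of \<open>\<tau>\<close> with an earlier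
    term, as each is bounded by the sum.\<close>
  define h where "h = Suc (\<Sum>j<k. common_edges \<tau> (boundary_point (s j)))"
  have h: "common_edges \<tau> (boundary_point (s j)) < h" if "j < k" for j
    unfolding h_def using that by (intro le_imp_less_Suc member_le_sum) auto
  obtain x where x: "x \<in> S"
      and close: "boundary_point x = \<tau> \<or> h \<le> common_edges \<tau> (boundary_point x)"
    using boundary_point_dense \<tau> by blast
  \<comment> \<open>An earlier term differs from \<open>\<tau>\<close> and shares fewer than
    \<open>h\<close> edges with it, so it cannot be this approximation.\<close>
  have ne: "boundary_point x \<noteq> boundary_point (s j)" if "j < k" for j
    using close h[OF that] \<tau> that by auto
  then have x_new: "x \<notin> s ` {..<k}" by auto
  \<comment> \<open>The ultrametric minimum is below \<open>h\<close>, so it is not attained by the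
    product of \<open>\<tau>\<close> with its approximation, which is at least
    \<open>h\<close>.\<close>
  have le: "common_edges (boundary_point x) (boundary_point (s j)) \<le> common_edges \<tau> (boundary_point (s j))"
    if j: "j < k" for j
  proof (cases "boundary_point x = \<tau>")
    case False
    then have "min (common_edges \<tau> (boundary_point x)) (common_edges (boundary_point x) (boundary_point (s j)))
        \<le> common_edges \<tau> (boundary_point (s j))"
      using \<tau> j mem[of j] x ne[OF j] by (intro ultra boundary_point_mem) auto
    then show ?thesis using close False h[OF j] by auto
  qed simp
  have "(\<Sum>j<k. common_edges (boundary_point (s k)) (boundary_point (s j)))
      = (\<Sum>j<k. nat_val (s k - s j))"
    using sum_common_edges_boundary_point[OF mem sub new] by simp
  also have "\<dots> \<le> (\<Sum>j<k. nat_val (x - s j))"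
    using greedy_ordering_min[OF s k] x x_new by blast
  also have "\<dots> = (\<Sum>j<k. common_edges (boundary_point x) (boundary_point (s j)))"
    using sum_common_edges_boundary_point[OF x sub x_new] by simp
  also have "\<dots> \<le> (\<Sum>j<k. common_edges \<tau> (boundary_point (s j)))"
    using le by (intro sum_mono) auto
  finally show "(\<Sum>j<k. common_edges (boundary_point (s k)) (boundary_point (s j)))
      \<le> (\<Sum>j<k. common_edges \<tau> (boundary_point (s j)))" .
qed

text \<open>The image of \<open>s\<close> is one tree ordering with this cost, and
  \<open>greedy_ordering_unique\<close> on the boundary gives every other tree ordering the same
  cost.\<close>

lemma tree_factorial_eq:
  assumes s: "greedy_ordering (\<lambda>x y. nat_val (x - y)) S n s"
  shows "tree_factorial T n = (\<Sum>j<n. nat_val (s n - s j))"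
  unfolding tree_factorial_def is_tree_ordering_iff
proof (rule the_equality)
  have sub: "s n \<in> S" "s ` {..<n} \<subseteq> S" using greedy_ordering_mem[OF s] by auto
  have eq: "(\<Sum>j<n. nat_val (s n - s j))
      = (\<Sum>j<n. common_edges (boundary_point (s n)) (boundary_point (s j)))"
    using sum_common_edges_boundary_point[OF sub greedy_ordering_notin[OF s order_refl]] by simp
  then show "\<exists>\<rho>. greedy_ordering common_edges (extended_boundary T) n \<rho> \<and>
      (\<Sum>j<n. nat_val (s n - s j)) = (\<Sum>j<n. common_edges (\<rho> n) (\<rho> j))"
    by (intro exI[of _ "\<lambda>k. boundary_point (s k)"] conjI greedy_ordering_boundary_point[OF s])
  fix m
  assume "\<exists>\<rho>. greedy_ordering common_edges (extended_boundary T) n \<rho> \<and>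
      m = (\<Sum>j<n. common_edges (\<rho> n) (\<rho> j))"
  then show "m = (\<Sum>j<n. nat_val (s n - s j))"
    using ultrametric_product.greedy_ordering_unique[OF boundary_ultrametric _
        greedy_ordering_boundary_point[OF s]] eq by auto
qed

text \<open>Independence of Bhargava's choices is inherited from the tree: each
  \<open>S\<close>-ordering has the tree factorial as its cost.\<close>

lemma bhargava_factorial_eq:
  assumes n: "finite S \<Longrightarrow> n < card S"
  shows "bhargava_factorial val S n = ereal (real (tree_factorial T n))"
proof -
  have val: "val (\<Prod>j<n. s n - s j) = ereal (real (tree_factorial T n))"
    if s: "greedy_ordering (\<lambda>x y. nat_val (x - y)) S n s" for s
    unfolding tree_factorial_eq[OF s]
    using greedy_ordering_mem[OF s] by (intro val_prod_diff greedy_ordering_notin[OF s]) auto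
  obtain s where s: "greedy_ordering (\<lambda>x y. nat_val (x - y)) S n s"
    using ex_greedy_ordering[of S n "\<lambda>x y. nat_val (x - y)"] n by blast
  have iff: "is_S_ordering val S n s = greedy_ordering (\<lambda>x y. nat_val (x - y)) S n s" for s
    using n by (rule is_S_ordering_iff)
  show ?thesis
    unfolding bhargava_factorial_def iff
  proof (rule the_equality)
    show "\<exists>s. greedy_ordering (\<lambda>x y. nat_val (x - y)) S n s \<and>
        ereal (real (tree_factorial T n)) = val (\<Prod>j<n. s n - s j)"
      using s val[OF s] by (intro exI[of _ s]) simp
  qed (use val in blast)
qed

end

theorem proposition1p2:
  fixes val :: "'k::field \<Rightarrow> ereal" and S :: "'k set" and n :: nat
  assumes "nonarch_local_field val"
    and "S \<subseteq> valuation_ring val" and "S \<noteq> {}"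
    and "finite S \<Longrightarrow> n < card S"
  shows "bhargava_factorial val S n = ereal (real (tree_factorial (adelic_tree val S) n))"
proof -
  interpret nonarch_local_field val by fact
  interpret adelic val S by unfold_locales (use assms in auto)
  show ?thesis using assms(4) by (rule bhargava_factorial_eq)
qed

end
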